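(* Let $\Pi_1$ and $\Pi_2$ be two (complex) inner products on $\mathbb{C}^n$, and let $X=\mathbb{C}^n$ be the complex normed space with the norm $$\|x\|=\sqrt{\max\{\Pi_1(x,x),\Pi_2(x,x)\}}.$$ Then every 2-polynomial defined on a linear subspace of $X$ can be extended to $X$ preserving the norm; that is, for every complex linear subspace $Y\subseteq X$ and every 2-polynomial $P:Y\to\mathbb{C}$ there is a 2-polynomial $\tilde P:X\to\mathbb{C}$ such that $\tilde P(y)=P(y)$ for all $y\in Y$ and $\|\tilde P\|=\|P\|$.
   Context: Let $Z$ be a normed linear space over $\mathbb{K}$ ($\mathbb{R}$ or $\mathbb{C}$; here $\mathbb{K}=\mathbb{C}$). A function $P:Z\to\mathbb{K}$ is a 2-polynomial if there is a $\mathbb{K}$-bilinear functional $\Pi:Z\times Z\to\mathbb{K}$ (linear, not conjugate-linear, in each variable) such that $P(x)=\Pi(x,x)$ for every $x\in Z$. The norm of $P$ is $\|P\|=\sup\{|P(x)|: x\in Z,\ \|x\|=1\}$. A linear subspace $Y$ of $X$ carries the norm restricted from $X$, so the norm of a 2-polynomial on $Y$ is the supremum over unit vectors of $Y$. *)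

theory Defs
  imports "HOL-Analysis.Analysis"
begin

definition linear_functional_on ::
    "(complex ^ 'n) set \<Rightarrow> (complex ^ 'n \<Rightarrow> complex) \<Rightarrow> bool" where
  "linear_functional_on Y f \<longleftrightarrow>
     (\<forall>x\<in>Y. \<forall>y\<in>Y. f (x + y) = f x + f y) \<and> (\<forall>c. \<forall>x\<in>Y. f (c *s x) = c * f x)"

lemma linear_functional_on_UNIV_iff:
  "linear_functional_on UNIV f \<longleftrightarrow> Vector_Spaces.linear (*s) (*) f"
proof -
  have "vector_space ((*s) :: complex \<Rightarrow> complex ^ 'n \<Rightarrow> complex ^ 'n)"
    by unfold_locales
  moreover have "vector_space ((*) :: complex \<Rightarrow> complex \<Rightarrow> complex)"
    by unfold_locales (simp_all add: algebra_simps)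
  ultimately show ?thesis
    by (auto simp: linear_functional_on_def Vector_Spaces.linear_iff)
qed

definition bilinear_functional_on ::
    "(complex ^ 'n) set \<Rightarrow> (complex ^ 'n \<Rightarrow> complex ^ 'n \<Rightarrow> complex) \<Rightarrow> bool" where
  "bilinear_functional_on Y B \<longleftrightarrow>
     (\<forall>y\<in>Y. linear_functional_on Y (\<lambda>x. B x y)) \<and> (\<forall>x\<in>Y. linear_functional_on Y (B x))"

text \<open>A function on a subspace \<open>Y\<close> is represented by a function on the whole space
  whose values outside \<open>Y\<close> are irrelevant.\<close>

definition two_polynomial_on ::
    "(complex ^ 'n) set \<Rightarrow> (complex ^ 'n \<Rightarrow> complex) \<Rightarrow> bool" where
  "two_polynomial_on Y P \<longleftrightarrow> (\<exists>B. bilinear_functional_on Y B \<and> (\<forall>x\<in>Y. P x = B x x))"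

text \<open>The norm \<open>N\<close> of the ambient space is a parameter. The supremum is taken in
  \<open>[0, \<infinity>]\<close>, so that the norm of a polynomial on the zero subspace, which has no unit
  vectors, is \<open>0\<close>; for real numbers the supremum of the empty set would be unspecified.\<close>

definition two_polynomial_norm ::
    "(complex ^ 'n \<Rightarrow> real) \<Rightarrow> (complex ^ 'n) set \<Rightarrow> (complex ^ 'n \<Rightarrow> complex) \<Rightarrow> ennreal" where
  "two_polynomial_norm N Y P = (SUP x \<in> {x \<in> Y. N x = 1}. ennreal (cmod (P x)))"

text \<open>Inner products are linear in the first and conjugate-linear in the second argument.
  Hermitian symmetry makes \<open>H x x\<close> real, so \<open>Re (H x x)\<close> is its value.\<close>

definition complex_inner_product ::
    "(complex ^ 'n \<Rightarrow> complex ^ 'n \<Rightarrow> complex) \<Rightarrow> bool" where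
  "complex_inner_product H \<longleftrightarrow>
     (\<forall>y. Vector_Spaces.linear (*s) (*) (\<lambda>x. H x y)) \<and>
     (\<forall>x y. H y x = cnj (H x y)) \<and>
     (\<forall>x. x \<noteq> 0 \<longrightarrow> Re (H x x) > 0)"

definition max_norm ::
    "(complex ^ 'n \<Rightarrow> complex ^ 'n \<Rightarrow> complex) \<Rightarrow> (complex ^ 'n \<Rightarrow> complex ^ 'n \<Rightarrow> complex) \<Rightarrow>
     complex ^ 'n \<Rightarrow> real" where
  "max_norm H\<^sub>1 H\<^sub>2 x = sqrt (max (Re (H\<^sub>1 x x)) (Re (H\<^sub>2 x x)))"

end

theory Submission
  imports Defs
begin

text \<open>Let \<open>c\<close> be the norm of \<open>P\<close>, so that \<open>\<bar>P\<bar> \<le> c max {\<Pi>\<^sub>1, \<Pi>\<^sub>2}\<close> on \<open>Y\<close> (with \<open>\<Pi>\<^sub>i\<close> short for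
  \<open>\<Pi>\<^sub>i(y, y)\<close>). The maximum of two inner products is in general not an inner product, but it can be replaced by one:
  the real quadratic forms \<open>c \<Pi>\<^sub>1 - Re P\<close> and \<open>c \<Pi>\<^sub>2 - Re P\<close> on \<open>Y\<close> are nowhere both negative, so by
  Yuan's lemma (\<open>convex_combination_nonneg\<close>), a form of the S-lemma, some convex combination of them
  is nonnegative. Hence \<open>Re P \<le> c H\<close> on \<open>Y\<close>, where \<open>H = (1 - t) \<Pi>\<^sub>1 + t \<Pi>\<^sub>2\<close>. Multiplying \<open>y\<close> by a
  unimodular scalar leaves \<open>H(y, y)\<close> unchanged and rotates \<open>P(y)\<close> arbitrarily, so even \<open>\<bar>P\<bar> \<le> c H\<close>.

  In a Hilbert space the extension problem is trivial: composing \<open>P\<close> with the \<open>H\<close>-orthogonal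
  projection \<open>p\<close> onto \<open>Y\<close> gives \<open>\<bar>P(p x)\<bar> \<le> c H(p x, p x) \<le> c H(x, x) \<le> c max {\<Pi>\<^sub>1, \<Pi>\<^sub>2}\<close>, because a
  convex combination does not exceed the maximum.\<close>

section \<open>Pairs of real quadratic forms\<close>

text \<open>Being a quadratic form is a condition on two-dimensional subspaces only, where it means being a
  homogeneous polynomial of degree two in the coordinates. Stated this way it needs no bilinear form on
  the whole space, and \<open>m\<close> is twice the polar form.\<close>

definition quadratic_form_on :: "'a::real_vector set \<Rightarrow> ('a \<Rightarrow> real) \<Rightarrow> bool" where
  "quadratic_form_on V q \<longleftrightarrow>
     (\<forall>x\<in>V. \<forall>y\<in>V. \<exists>m. \<forall>a b. q (a *\<^sub>R x + b *\<^sub>R y) = a\<^sup>2 * q x + a * b * m + b\<^sup>2 * q y)"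

lemma quadratic_form_on_combination:
  assumes "quadratic_form_on V f" "quadratic_form_on V g"
  shows "quadratic_form_on V (\<lambda>x. r * f x + s * g x)"
  unfolding quadratic_form_on_def
proof (intro ballI)
  fix x y assume xy: "x \<in> V" "y \<in> V"
  obtain m where m: "\<And>a b. f (a *\<^sub>R x + b *\<^sub>R y) = a\<^sup>2 * f x + a * b * m + b\<^sup>2 * f y"
    using assms(1) xy unfolding quadratic_form_on_def by blast
  obtain n where n: "\<And>a b. g (a *\<^sub>R x + b *\<^sub>R y) = a\<^sup>2 * g x + a * b * n + b\<^sup>2 * g y"
    using assms(2) xy unfolding quadratic_form_on_def by blast
  show "\<exists>k. \<forall>a b. r * f (a *\<^sub>R x + b *\<^sub>R y) + s * g (a *\<^sub>R x + b *\<^sub>R y) =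
      a\<^sup>2 * (r * f x + s * g x) + a * b * k + b\<^sup>2 * (r * f y + s * g y)"
    by (rule exI[of _ "r * m + s * n"]) (simp add: m n algebra_simps)
qed

text \<open>This covers both bilinear and sesquilinear functionals: they differ only in their behaviour
  under non-real scalars.\<close>

lemma quadratic_form_on_Re_diagonal:
  fixes B :: "'a::real_vector \<Rightarrow> 'a \<Rightarrow> complex"
  assumes V: "subspace V"
    and add_left: "\<And>x y z. x \<in> V \<Longrightarrow> y \<in> V \<Longrightarrow> z \<in> V \<Longrightarrow> B (x + y) z = B x z + B y z"
    and add_right: "\<And>x y z. x \<in> V \<Longrightarrow> y \<in> V \<Longrightarrow> z \<in> V \<Longrightarrow> B z (x + y) = B z x + B z y"
    and scale_left: "\<And>a x y. x \<in> V \<Longrightarrow> y \<in> V \<Longrightarrow> B (a *\<^sub>R x) y = complex_of_real a * B x y"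
    and scale_right: "\<And>a x y. x \<in> V \<Longrightarrow> y \<in> V \<Longrightarrow> B x (a *\<^sub>R y) = complex_of_real a * B x y"
  shows "quadratic_form_on V (\<lambda>x. Re (B x x))"
  unfolding quadratic_form_on_def
proof (intro ballI exI allI)
  fix x y a b assume xy: "x \<in> V" "y \<in> V"
  have mem: "a *\<^sub>R x \<in> V" "b *\<^sub>R y \<in> V" "a *\<^sub>R x + b *\<^sub>R y \<in> V"
    using V xy by (simp_all add: subspace_add subspace_scale)
  show "Re (B (a *\<^sub>R x + b *\<^sub>R y) (a *\<^sub>R x + b *\<^sub>R y)) =
      a\<^sup>2 * Re (B x x) + a * b * (Re (B x y) + Re (B y x)) + b\<^sup>2 * Re (B y y)"
    using xy mem
    by (simp add: add_left add_right scale_left scale_right power2_eq_square algebra_simps)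
qed

text \<open>If a quadratic form is negative at \<open>x\<close> and \<open>y\<close>, then it is negative on the whole segment from \<open>x\<close> to
  \<open>y\<close> or on that from \<open>x\<close> to \<open>-y\<close>, whichever makes the mixed term nonpositive. Apply this to
  \<open>(1 - t) f + t g\<close>: the segment is covered by the open sets where \<open>f < 0\<close> and where \<open>g < 0\<close>. Both are
  nonempty and the segment is connected, so they meet.\<close>

lemma common_negative_point:
  assumes V: "subspace V" and f: "quadratic_form_on V f" and g: "quadratic_form_on V g"
    and t: "0 \<le> t" "t \<le> 1"
    and x: "x \<in> V" "f x < 0" "(1 - t) * f x + t * g x < 0"
    and y: "y \<in> V" "g y < 0" "(1 - t) * f y + t * g y < 0"
  shows "\<exists>z\<in>V. f z < 0 \<and> g z < 0"
proof -
  obtain m where m: "\<And>a b. f (a *\<^sub>R x + b *\<^sub>R y) = a\<^sup>2 * f x + a * b * m + b\<^sup>2 * f y"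
    using f x y unfolding quadratic_form_on_def by blast
  obtain n where n: "\<And>a b. g (a *\<^sub>R x + b *\<^sub>R y) = a\<^sup>2 * g x + a * b * n + b\<^sup>2 * g y"
    using g x y unfolding quadratic_form_on_def by blast
  define k where "k = (1 - t) * m + t * n"
  obtain s :: real where s: "s\<^sup>2 = 1" "s * k \<le> 0"
  proof (cases "k \<le> 0")
    case True
    then show ?thesis using that[of 1] by simp
  next
    case False
    then show ?thesis using that[of "-1"] by simp
  qed
  define z where "z u = (1 - u) *\<^sub>R x + (u * s) *\<^sub>R y" for u
  have zV: "z u \<in> V" for u
    using V x y by (simp add: z_def subspace_add subspace_scale)
  have us: "(u * s)\<^sup>2 = u\<^sup>2" for u using s by (simp add: power_mult_distrib)
  have fz: "f (z u) = (1 - u)\<^sup>2 * f x + (1 - u) * (u * s) * m + u\<^sup>2 * f y" for u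
    by (simp add: z_def m us)
  have gz: "g (z u) = (1 - u)\<^sup>2 * g x + (1 - u) * (u * s) * n + u\<^sup>2 * g y" for u
    by (simp add: z_def n us)
  have combination_neg: "(1 - t) * f (z u) + t * g (z u) < 0" if u: "u \<in> {0..1}" for u
  proof -
    let ?p = "(1 - t) * f x + t * g x" and ?q = "(1 - t) * f y + t * g y"
    have eq: "(1 - t) * f (z u) + t * g (z u) =
        (1 - u)\<^sup>2 * ?p + ((1 - u) * u) * (s * k) + u\<^sup>2 * ?q"
      by (simp add: fz gz k_def algebra_simps)
    have "((1 - u) * u) * (s * k) \<le> 0"
      using u by (intro mult_nonneg_nonpos[OF _ s(2)]) simp
    moreover have "(1 - u)\<^sup>2 * ?p \<le> 0" "u\<^sup>2 * ?q \<le> 0"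
      using x(3) y(3) by (simp_all add: mult_nonneg_nonpos)
    moreover have "(1 - u)\<^sup>2 * ?p < 0 \<or> u\<^sup>2 * ?q < 0"
      using x(3) y(3) by (cases "u = 0") (simp_all add: mult_pos_neg)
    ultimately show ?thesis unfolding eq by linarith
  qed
  have cover: "f (z u) < 0 \<or> g (z u) < 0" if u: "u \<in> {0..1}" for u
  proof (rule ccontr)
    assume "\<not> ?thesis"
    then have "0 \<le> (1 - t) * f (z u) + t * g (z u)" using t by simp
    then show False using combination_neg[OF u] by linarith
  qed
  have "open {u. f (z u) < 0}" "open {u. g (z u) < 0}"
    unfolding fz gz by (intro open_Collect_less continuous_intros)+
  moreover have "0 \<in> {u. f (z u) < 0} \<inter> {0..1}" "1 \<in> {u. g (z u) < 0} \<inter> {0..1}"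
    using x y by (simp_all add: fz gz)
  moreover have "connected {0..1::real}" by simp
  ultimately have "{u. f (z u) < 0} \<inter> {u. g (z u) < 0} \<inter> {0..1} \<noteq> {}"
    using connectedD[of "{0..1::real}" "{u. f (z u) < 0}" "{u. g (z u) < 0}"] cover by blast
  then show ?thesis using zV by blast
qed

text \<open>If every convex combination took a negative value, the parameters \<open>t\<close> would be covered by two open
  sets, according to which of \<open>f\<close> and \<open>g\<close> is negative at a point where the combination is. They contain
  \<open>0\<close> and \<open>1\<close> respectively, so they share a parameter, to which \<open>common_negative_point\<close> applies.\<close>

lemma convex_combination_nonneg:
  assumes V: "subspace V" and f: "quadratic_form_on V f" and g: "quadratic_form_on V g"
    and nonneg: "\<And>x. x \<in> V \<Longrightarrow> 0 \<le> f x \<or> 0 \<le> g x"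
  shows "\<exists>t\<in>{0..1}. \<forall>x\<in>V. 0 \<le> (1 - t) * f x + t * g x"
proof (rule ccontr)
  assume no: "\<not> ?thesis"
  define U where "U h = (\<Union>x\<in>{x\<in>V. h x < 0}. {t. (1 - t) * f x + t * g x < 0})" for h :: "'a \<Rightarrow> real"
  have "open (U h)" for h
    unfolding U_def by (intro open_UN ballI open_Collect_less continuous_intros)
  moreover have "{0..1} \<subseteq> U f \<union> U g"
  proof
    fix t :: real assume t: "t \<in> {0..1}"
    then obtain x where x: "x \<in> V" "(1 - t) * f x + t * g x < 0"
      using no by (meson not_le)
    have "f x < 0 \<or> g x < 0"
    proof (rule ccontr)
      assume "\<not> ?thesis"
      then have "0 \<le> (1 - t) * f x + t * g x" using t by simp
      then show False using x(2) by linarith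
    qed
    then show "t \<in> U f \<union> U g" using x by (auto simp: U_def)
  qed
  moreover have "0 \<in> U f"
  proof -
    obtain x where "x \<in> V" "(1 - 0) * f x + 0 * g x < 0"
      using no by (metis atLeastAtMost_iff not_le order_refl zero_le_one)
    then show ?thesis by (auto simp: U_def)
  qed
  moreover have "1 \<in> U g"
  proof -
    obtain x where "x \<in> V" "(1 - 1) * f x + 1 * g x < 0"
      using no by (metis atLeastAtMost_iff not_le order_refl zero_le_one)
    then show ?thesis by (auto simp: U_def)
  qed
  moreover have "connected {0..1::real}" by simp
  ultimately obtain t where t: "t \<in> {0..1}" "t \<in> U f" "t \<in> U g"
    using connectedD[of "{0..1::real}" "U f" "U g"] by fastforce
  then obtain x y where "x \<in> V" "f x < 0" "(1 - t) * f x + t * g x < 0"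
      "y \<in> V" "g y < 0" "(1 - t) * f y + t * g y < 0"
    by (auto simp: U_def)
  then obtain z where "z \<in> V" "f z < 0" "g z < 0"
    using common_negative_point[OF V f g] t(1) by (meson atLeastAtMost_iff)
  then show False using nonneg by force
qed

section \<open>Complex inner products and orthogonal projections\<close>

lemma complex_inner_productD:
  assumes "complex_inner_product H"
  shows inner_add_left: "H (x + y) z = H x z + H y z"
    and inner_scale_left: "H (c *s x) z = c * H x z"
    and inner_commute: "H y x = cnj (H x y)"
    and inner_pos: "x \<noteq> 0 \<Longrightarrow> 0 < Re (H x x)"
proof -
  have "linear_functional_on UNIV (\<lambda>x. H x z)"
    using assms unfolding complex_inner_product_def linear_functional_on_UNIV_iff by blast
  then show "H (x + y) z = H x z + H y z" "H (c *s x) z = c * H x z"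
    unfolding linear_functional_on_def by simp_all
  show "H y x = cnj (H x y)"
    using assms unfolding complex_inner_product_def by blast
  show "0 < Re (H x x)" if "x \<noteq> 0"
    using assms that unfolding complex_inner_product_def by blast
qed

lemma inner_add_right:
  assumes "complex_inner_product H"
  shows "H z (x + y) = H z x + H z y"
  unfolding inner_commute[OF assms, of z "x + y"] inner_commute[OF assms, of z x]
    inner_commute[OF assms, of z y]
  by (simp add: inner_add_left[OF assms])

lemma inner_scale_right:
  assumes "complex_inner_product H"
  shows "H z (c *s x) = cnj c * H z x"
  unfolding inner_commute[OF assms, of z "c *s x"] inner_commute[OF assms, of z x]
  by (simp add: inner_scale_left[OF assms])

lemma inner_minus_left:
  assumes "complex_inner_product H"
  shows "H (x - y) z = H x z - H y z"
  using inner_add_left[OF assms, of "x - y" y z] by simp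

lemma inner_zero_left:
  assumes "complex_inner_product H"
  shows "H 0 z = 0"
  using inner_minus_left[OF assms, of 0 0 z] by simp

lemma inner_nonneg:
  assumes "complex_inner_product H"
  shows "0 \<le> Re (H x x)"
  using inner_pos[OF assms, of x] inner_zero_left[OF assms] by (cases "x = 0") auto

lemma inner_scale_diagonal:
  assumes "complex_inner_product H"
  shows "Re (H (c *s x) (c *s x)) = (cmod c)\<^sup>2 * Re (H x x)"
proof -
  have "H (c *s x) (c *s x) = (c * cnj c) * H x x"
    by (simp add: inner_scale_left[OF assms] inner_scale_right[OF assms])
  also have "\<dots> = complex_of_real ((cmod c)\<^sup>2) * H x x"
    by (simp only: complex_norm_square)
  finally show ?thesis by simp
qed

lemma complex_inner_product_convex:
  assumes H: "complex_inner_product H" and K: "complex_inner_product K" and t: "t \<in> {0..1}"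
  shows "complex_inner_product (\<lambda>x y. complex_of_real (1 - t) * H x y + complex_of_real t * K x y)"
  unfolding complex_inner_product_def
proof (intro conjI allI impI)
  fix y
  show "Vector_Spaces.linear (*s) (*)
      (\<lambda>x. complex_of_real (1 - t) * H x y + complex_of_real t * K x y)"
    unfolding linear_functional_on_UNIV_iff[symmetric] linear_functional_on_def
    by (simp add: inner_add_left[OF H] inner_add_left[OF K]
        inner_scale_left[OF H] inner_scale_left[OF K] algebra_simps)
next
  fix x y
  show "complex_of_real (1 - t) * H y x + complex_of_real t * K y x =
      cnj (complex_of_real (1 - t) * H x y + complex_of_real t * K x y)"
    by (simp add: inner_commute[OF H, of y x] inner_commute[OF K, of y x])
next
  fix x :: "complex ^ 'a" assume "x \<noteq> 0"
  then have pos: "0 < Re (H x x)" "0 < Re (K x x)"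
    using inner_pos[OF H] inner_pos[OF K] by auto
  have "0 < (1 - t) * Re (H x x) + t * Re (K x x)"
  proof (cases "t = 0")
    case False
    then have "0 < t * Re (K x x)" using t pos by simp
    moreover have "0 \<le> (1 - t) * Re (H x x)" using t pos by simp
    ultimately show ?thesis by linarith
  qed (use pos in simp)
  then show "0 < Re (complex_of_real (1 - t) * H x x + complex_of_real t * K x x)"
    by simp
qed

text \<open>One Gram-Schmidt step per element of the spanning set.\<close>

lemma orthogonal_decomposition_span:
  fixes S :: "(complex ^ 'n) set"
  assumes H: "complex_inner_product H" and "finite S"
  shows "\<exists>p\<in>vec.span S. \<forall>s\<in>vec.span S. H (x - p) s = 0"
  using \<open>finite S\<close>
proof (induction S arbitrary: x rule: finite_induct)
  case empty
  have "H z 0 = 0" for z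
    using inner_zero_left[OF H] inner_commute[OF H, of 0 z] by simp
  then show ?case by simp
next
  case (insert a S)
  obtain q where q: "q \<in> vec.span S" "\<And>s. s \<in> vec.span S \<Longrightarrow> H (a - q) s = 0"
    using insert.IH by blast
  obtain p where p: "p \<in> vec.span S" "\<And>s. s \<in> vec.span S \<Longrightarrow> H (x - p) s = 0"
    using insert.IH by blast
  define e where "e = a - q"
  \<comment> \<open>If \<open>e = 0\<close>, the quotient is \<open>0\<close> and nothing is added to \<open>p\<close>.\<close>
  define c where "c = H (x - p) e / H e e"
  have sub: "vec.span S \<subseteq> vec.span (insert a S)"
    by (rule vec.span_mono) auto
  have e: "e \<in> vec.span (insert a S)"
    unfolding e_def using q sub by (blast intro: vec.span_diff vec.span_base)
  have orth: "H (x - (p + c *s e)) w = H (x - p) w - c * H e w" for w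
    by (simp add: diff_diff_eq[symmetric] inner_minus_left[OF H] inner_scale_left[OF H])
  have "H (x - (p + c *s e)) s = 0" if s: "s \<in> vec.span (insert a S)" for s
  proof -
    obtain k where k: "s - k *s a \<in> vec.span S"
      using s vec.span_insert[of a S] by blast
    define r where "r = (s - k *s a) + k *s q"
    have r: "r \<in> vec.span S"
      unfolding r_def using k q by (blast intro: vec.span_add vec.span_scale)
    have s_eq: "s = r + k *s e"
      by (simp add: r_def e_def vec.scale_right_diff_distrib)
    have "H (x - p) e - c * H e e = 0"
    proof (cases "e = 0")
      case True
      then show ?thesis
        using inner_zero_left[OF H] inner_commute[OF H, of e "x - p"] by simp
    next
      case False
      then have "H e e \<noteq> 0" using inner_pos[OF H] by force
      then show ?thesis by (simp add: c_def)
    qed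
    moreover have "H e r = 0" "H (x - p) r = 0" using q p r by (auto simp: e_def)
    ultimately show ?thesis
      by (simp add: s_eq inner_add_right[OF H] inner_scale_right[OF H] orth)
  qed
  moreover have "p + c *s e \<in> vec.span (insert a S)"
    using p sub e by (blast intro: vec.span_add vec.span_scale)
  ultimately show ?case by blast
qed

text \<open>The projection is linear because orthogonality to \<open>Y\<close> determines it, and it is a contraction by
  Pythagoras.\<close>

lemma orthogonal_projection_exists:
  fixes Y :: "(complex ^ 'n) set"
  assumes H: "complex_inner_product H" and Y: "vec.subspace Y"
  shows "\<exists>p. (\<forall>x. p x \<in> Y) \<and> (\<forall>y\<in>Y. p y = y) \<and> (\<forall>x y. p (x + y) = p x + p y) \<and>
    (\<forall>c x. p (c *s x) = c *s p x) \<and> (\<forall>x. Re (H (p x) (p x)) \<le> Re (H x x))"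
proof -
  obtain S where S: "finite S" "vec.span S = Y"
    by (metis Y vec.basis_exists vec.span_subspace vec.finiteI_independent)
  have "\<exists>q. q \<in> Y \<and> (\<forall>s\<in>Y. H (x - q) s = 0)" for x
    using orthogonal_decomposition_span[OF H S(1), of x] S(2) by blast
  then obtain p where pY: "\<And>x. p x \<in> Y" and orth: "\<And>x s. s \<in> Y \<Longrightarrow> H (x - p x) s = 0"
    by metis
  have unique: "p x = q" if q: "q \<in> Y" "\<And>s. s \<in> Y \<Longrightarrow> H (x - q) s = 0" for x q
  proof -
    have d: "p x - q \<in> Y" using pY q Y by (simp add: vec.subspace_diff)
    have "H (p x - q) (p x - q) = H (x - q) (p x - q) - H (x - p x) (p x - q)"
      by (simp add: inner_minus_left[OF H])
    then have "H (p x - q) (p x - q) = 0" using d q orth by simp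
    then show ?thesis using inner_pos[OF H, of "p x - q"] by force
  qed
  have "p y = y" if "y \<in> Y" for y
    using that by (intro unique) (simp_all add: inner_zero_left[OF H])
  moreover have "p (x + y) = p x + p y" for x y
  proof (rule unique)
    show "p x + p y \<in> Y" using pY Y by (simp add: vec.subspace_add)
    show "H (x + y - (p x + p y)) s = 0" if "s \<in> Y" for s
      using orth[OF that, of x] orth[OF that, of y]
      by (simp add: inner_minus_left[OF H] inner_add_left[OF H])
  qed
  moreover have "p (c *s x) = c *s p x" for c x
  proof (rule unique)
    show "c *s p x \<in> Y" using pY Y by (simp add: vec.subspace_scale)
    show "H (c *s x - c *s p x) s = 0" if "s \<in> Y" for s
      using orth[OF that, of x]
      by (simp add: inner_minus_left[OF H] inner_scale_left[OF H])
  qed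
  moreover have "Re (H (p x) (p x)) \<le> Re (H x x)" for x
  proof -
    have o: "H (x - p x) (p x) = 0" "H (p x) (x - p x) = 0"
      using orth[OF pY[of x], of x] inner_commute[OF H, of "p x" "x - p x"] by simp_all
    have "H x x = H ((x - p x) + p x) ((x - p x) + p x)" by simp
    also have "\<dots> = H (x - p x) (x - p x) + H (p x) (p x)"
      unfolding inner_add_left[OF H] inner_add_right[OF H] using o by simp
    finally show ?thesis using inner_nonneg[OF H, of "x - p x"] by simp
  qed
  ultimately show ?thesis using pY by blast
qed

section \<open>Domination of a 2-polynomial by a single inner product\<close>

lemma scaleR_eq_scale_of_real: "a *\<^sub>R x = complex_of_real a *s (x :: complex ^ 'n)"
  by (simp add: vec_eq_iff) (simp add: scaleR_conv_of_real)

lemma complex_subspace_imp_real_subspace: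
  fixes Y :: "(complex ^ 'n) set"
  assumes "vec.subspace Y"
  shows "subspace Y"
  using assms by (auto simp: subspace_def vec.subspace_def scaleR_eq_scale_of_real)

lemma bilinear_functional_onD:
  assumes "bilinear_functional_on Y B" "x \<in> Y" "z \<in> Y"
  shows "y \<in> Y \<Longrightarrow> B (x + y) z = B x z + B y z" "y \<in> Y \<Longrightarrow> B z (x + y) = B z x + B z y"
    "B (c *s x) z = c * B x z" "B z (c *s x) = c * B z x"
  using assms by (simp_all add: bilinear_functional_on_def linear_functional_on_def)

text \<open>Yuan's lemma yields a bound for the real part of \<open>B y y\<close>. It becomes a bound for the modulus
  when applied to \<open>w y\<close>, with \<open>w\<^sup>2\<close> the conjugate phase of \<open>B y y\<close>.\<close>

lemma dominated_by_convex_combination: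
  fixes Y :: "(complex ^ 'n) set"
  assumes H: "complex_inner_product H" and K: "complex_inner_product K"
    and Y: "vec.subspace Y" and B: "bilinear_functional_on Y B"
    and bound: "\<And>y. y \<in> Y \<Longrightarrow> cmod (B y y) \<le> c * max (Re (H y y)) (Re (K y y))"
  shows "\<exists>t\<in>{0..1}. \<forall>y\<in>Y. cmod (B y y) \<le> c * ((1 - t) * Re (H y y) + t * Re (K y y))"
proof -
  have V: "subspace Y" by (rule complex_subspace_imp_real_subspace[OF Y])
  have qB: "quadratic_form_on Y (\<lambda>y. Re (B y y))"
    using V by (rule quadratic_form_on_Re_diagonal)
      (simp_all add: bilinear_functional_onD[OF B] scaleR_eq_scale_of_real)
  have q_inner: "quadratic_form_on Y (\<lambda>y. Re (G y y))" if G: "complex_inner_product G" for G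
    using V by (rule quadratic_form_on_Re_diagonal)
      (simp_all add: inner_add_left[OF G] inner_add_right[OF G] inner_scale_left[OF G]
        inner_scale_right[OF G] scaleR_eq_scale_of_real)
  have q: "quadratic_form_on Y (\<lambda>y. c * Re (G y y) + (- 1) * Re (B y y))"
    if "complex_inner_product G" for G
    using q_inner[OF that] qB by (rule quadratic_form_on_combination)
  have "0 \<le> c * Re (H y y) + (- 1) * Re (B y y) \<or> 0 \<le> c * Re (K y y) + (- 1) * Re (B y y)"
    if "y \<in> Y" for y
    using bound[OF that] complex_Re_le_cmod[of "B y y"] by (auto simp: max_def split: if_splits)
  from convex_combination_nonneg[OF V q[OF H] q[OF K] this]
  obtain t where t: "t \<in> {0..1}"
    and nonneg: "\<And>y. y \<in> Y \<Longrightarrow> 0 \<le> (1 - t) * (c * Re (H y y) + (- 1) * Re (B y y)) +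
        t * (c * Re (K y y) + (- 1) * Re (B y y))"
    by blast
  have Re_bound: "Re (B y y) \<le> c * ((1 - t) * Re (H y y) + t * Re (K y y))" if "y \<in> Y" for y
    using nonneg[OF that] by (simp add: algebra_simps)
  have "cmod (B y y) \<le> c * ((1 - t) * Re (H y y) + t * Re (K y y))" if y: "y \<in> Y" for y
  proof -
    \<comment> \<open>At a zero of \<open>B y y\<close> any unimodular \<open>w\<close> works.\<close>
    obtain w where w: "cmod w = 1" "w\<^sup>2 * B y y = complex_of_real (cmod (B y y))"
    proof (cases "B y y = 0")
      case True
      then show ?thesis using that[of 1] by simp
    next
      case False
      let ?w = "csqrt (cnj (B y y) / complex_of_real (cmod (B y y)))"
      have "cmod ?w = 1" using False by (simp add: norm_divide)
      moreover have "?w\<^sup>2 * B y y = complex_of_real (cmod (B y y))"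
      proof -
        have "cnj (B y y) * B y y = complex_of_real (cmod (B y y)) * complex_of_real (cmod (B y y))"
          using complex_norm_square[of "B y y"] by (simp add: power2_eq_square mult.commute)
        then show ?thesis using False by (simp add: field_simps)
      qed
      ultimately show ?thesis by (rule that)
    qed
    have wy: "w *s y \<in> Y" using Y y by (simp add: vec.subspace_scale)
    have "B (w *s y) (w *s y) = w\<^sup>2 * B y y"
      using y wy by (simp add: bilinear_functional_onD[OF B] power2_eq_square)
    then have "cmod (B y y) = Re (B (w *s y) (w *s y))" by (simp add: w)
    also have "\<dots> \<le> c * ((1 - t) * Re (H y y) + t * Re (K y y))"
      using Re_bound[OF wy] w(1)
      by (simp add: inner_scale_diagonal[OF H] inner_scale_diagonal[OF K])
    finally show ?thesis .
  qed
  then show ?thesis using t by blast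
qed

section \<open>Norm-preserving extension\<close>

text \<open>Homogeneity of degree two carries the bound from unit vectors to all vectors.\<close>

lemma two_polynomial_norm_bound:
  fixes Y :: "(complex ^ 'n) set"
  assumes H: "complex_inner_product H" and K: "complex_inner_product K"
    and Y: "vec.subspace Y" and B: "bilinear_functional_on Y B" and P: "\<And>x. x \<in> Y \<Longrightarrow> P x = B x x"
    and norm: "two_polynomial_norm (max_norm H K) Y P \<le> ennreal c" and c: "0 \<le> c"
    and y: "y \<in> Y"
  shows "cmod (B y y) \<le> c * max (Re (H y y)) (Re (K y y))"
proof (cases "y = 0")
  case True
  have "B (0 *s y) y = 0" using bilinear_functional_onD(3)[OF B y y, of 0] by simp
  then show ?thesis
    using True by (simp add: inner_zero_left[OF H] inner_zero_left[OF K])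
next
  case False
  define M where "M = max (Re (H y y)) (Re (K y y))"
  have M: "0 < M" using inner_pos[OF H False] by (simp add: M_def)
  define a where "a = complex_of_real (1 / sqrt M)"
  have a: "(cmod a)\<^sup>2 = 1 / M" using M by (simp add: a_def norm_divide power_divide)
  have ay: "a *s y \<in> Y" using Y y by (simp add: vec.subspace_scale)
  have "max (Re (H (a *s y) (a *s y))) (Re (K (a *s y) (a *s y))) = (1 / M) * M"
    unfolding inner_scale_diagonal[OF H] inner_scale_diagonal[OF K] a
    using M max_mult_distrib_left[of "1 / M" "Re (H y y)" "Re (K y y)"]
    by (simp flip: M_def)
  then have "max_norm H K (a *s y) = 1" using M by (simp add: max_norm_def)
  then have "ennreal (cmod (P (a *s y))) \<le> two_polynomial_norm (max_norm H K) Y P"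
    unfolding two_polynomial_norm_def using ay by (intro SUP_upper) auto
  then have "cmod (P (a *s y)) \<le> c"
    using norm c by (meson ennreal_le_iff order_trans)
  moreover have "B (a *s y) (a *s y) = a\<^sup>2 * B y y"
    using y ay by (simp add: bilinear_functional_onD[OF B] power2_eq_square)
  ultimately have "(1 / M) * cmod (B y y) \<le> c"
    using P[OF ay] a by (simp add: norm_mult norm_power)
  then show ?thesis using M by (simp add: M_def[symmetric] field_simps)
qed

text \<open>The norm takes values in \<open>[0, \<infinity>]\<close>. If it were infinite, every extension would preserve it, so that
  case asks for nothing but some extension, and any \<open>t\<close> supplies one.\<close>

theorem theorem4:
  fixes \<Pi>\<^sub>1 \<Pi>\<^sub>2 :: "complex ^ 'n \<Rightarrow> complex ^ 'n \<Rightarrow> complex"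
    and Y :: "(complex ^ 'n) set"
    and P :: "complex ^ 'n \<Rightarrow> complex"
  assumes "complex_inner_product \<Pi>\<^sub>1"
    and "complex_inner_product \<Pi>\<^sub>2"
    and "vec.subspace Y"
    and "two_polynomial_on Y P"
  shows "\<exists>Q. two_polynomial_on UNIV Q \<and> (\<forall>y\<in>Y. Q y = P y) \<and>
           two_polynomial_norm (max_norm \<Pi>\<^sub>1 \<Pi>\<^sub>2) UNIV Q =
           two_polynomial_norm (max_norm \<Pi>\<^sub>1 \<Pi>\<^sub>2) Y P"
proof -
  let ?N = "max_norm \<Pi>\<^sub>1 \<Pi>\<^sub>2"
  let ?H = "\<lambda>t x y. complex_of_real (1 - t) * \<Pi>\<^sub>1 x y + complex_of_real t * \<Pi>\<^sub>2 x y"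
  define C where "C = two_polynomial_norm ?N Y P"
  obtain B where B: "bilinear_functional_on Y B" and P: "\<And>x. x \<in> Y \<Longrightarrow> P x = B x x"
    using assms(4) unfolding two_polynomial_on_def by blast
  obtain t where t: "t \<in> {0..1}"
    and dominated: "C \<noteq> \<infinity> \<Longrightarrow> \<forall>y\<in>Y. cmod (B y y) \<le> enn2real C * Re (?H t y y)"
  proof (cases "C = \<infinity>")
    case True
    then show ?thesis using that[of 0] by simp
  next
    case False
    have "C \<le> ennreal (enn2real C)" using False by (simp add: less_top)
    then have "cmod (B y y) \<le> enn2real C * max (Re (\<Pi>\<^sub>1 y y)) (Re (\<Pi>\<^sub>2 y y))" if "y \<in> Y" for y
      using two_polynomial_norm_bound[OF assms(1-3) B P] that by (simp add: C_def)
    from dominated_by_convex_combination[OF assms(1-3) B this] show ?thesis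
      using that by auto
  qed
  have H: "complex_inner_product (?H t)"
    by (rule complex_inner_product_convex[OF assms(1,2) t])
  obtain p where pY: "\<And>x. p x \<in> Y" and fixed: "\<And>y. y \<in> Y \<Longrightarrow> p y = y"
    and p_add: "\<And>x y. p (x + y) = p x + p y" and p_scale: "\<And>c x. p (c *s x) = c *s p x"
    and contraction: "\<And>x. Re (?H t (p x) (p x)) \<le> Re (?H t x x)"
    using orthogonal_projection_exists[OF H assms(3)] by blast
  define Q where "Q x = B (p x) (p x)" for x
  have "bilinear_functional_on UNIV (\<lambda>x y. B (p x) (p y))"
    using pY by (simp add: bilinear_functional_on_def linear_functional_on_def p_add p_scale
        bilinear_functional_onD[OF B])
  then have two_poly: "two_polynomial_on UNIV Q"
    unfolding two_polynomial_on_def Q_def by blast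
  have ext: "Q y = P y" if "y \<in> Y" for y
    using that by (simp add: Q_def fixed P)
  have "C \<le> two_polynomial_norm ?N UNIV Q"
    unfolding C_def two_polynomial_norm_def using ext by (intro SUP_mono) force
  moreover have "two_polynomial_norm ?N UNIV Q \<le> C"
  proof (cases "C = \<infinity>")
    case False
    show ?thesis
      unfolding two_polynomial_norm_def
    proof (rule SUP_least)
      fix x assume "x \<in> {x \<in> UNIV. ?N x = 1}"
      then have unit: "max (Re (\<Pi>\<^sub>1 x x)) (Re (\<Pi>\<^sub>2 x x)) = 1" by (simp add: max_norm_def)
      have "Re (?H t x x) = (1 - t) * Re (\<Pi>\<^sub>1 x x) + t * Re (\<Pi>\<^sub>2 x x)" by simp
      also have "\<dots> \<le> 1"
        using t unit by (intro convex_bound_le) (auto simp: max_def split: if_splits)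
      finally have "Re (?H t (p x) (p x)) \<le> 1" using contraction[of x] by linarith
      then have "enn2real C * Re (?H t (p x) (p x)) \<le> enn2real C"
        by (metis enn2real_nonneg mult.right_neutral mult_left_mono)
      then have "cmod (Q x) \<le> enn2real C"
        using dominated[OF False] pY[of x] unfolding Q_def by (meson order_trans)
      then show "ennreal (cmod (Q x)) \<le> C"
        using False by (metis ennreal_enn2real ennreal_leI infinity_ennreal_def less_top)
    qed
  qed simp
  ultimately show ?thesis using two_poly ext unfolding C_def by (blast intro: antisym)
qed

end
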